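(* Let $\mathcal{H}$ be a complex separable Hilbert space and let $E$ be a multivalued projection on $\mathcal{H}$. Then $E$ is an operator range relation (i.e. a semiclosed linear relation) if and only if $\operatorname{ran} E$ and $\ker E$ are semiclosed subspaces of $\mathcal{H}$.
   Context: A linear relation on $\mathcal{H}$ is a linear subspace $E$ of $\mathcal{H}\times\mathcal{H}$; $\operatorname{dom}E=\{x:(x,y)\in E \text{ for some } y\}$, $\operatorname{ran}E=\{y:(x,y)\in E\text{ for some }x\}$, $\ker E=\{x:(x,0)\in E\}$. The product of relations is $RT=\{(x,y): (x,z)\in T,\ (z,y)\in R\text{ for some }z\}$. A multivalued projection is a linear relation $E$ on $\mathcal{H}$ with $\operatorname{ran}E\subseteq\operatorname{dom}E$ and $E^2=E$. A subspace $\mathcal{S}$ of a Hilbert space is semiclosed (equivalently, an operator range) if it is the range of a bounded linear operator from some Hilbert space into the given space; equivalently, it carries an inner product making it a Hilbert space continuously embedded in the given one. A linear relation on $\mathcal{H}$ is an operator range (semiclosed) relation if it is a semiclosed subspace of $\mathcal{H}\times\mathcal{H}$, i.e. it is the range of some bounded operator from a Hilbert space into $\mathcal{H}\times\mathcal{H}$. *)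

theory Defs
  imports "HOL-Analysis.Analysis"
begin

section \<open>Complex Hilbert spaces\<close>

class complex_vector = ab_group_add +
  fixes scaleC :: "complex \<Rightarrow> 'a \<Rightarrow> 'a" (infixr \<open>*\<^sub>C\<close> 75)
  assumes scaleC_add_right: "a *\<^sub>C (x + y) = a *\<^sub>C x + a *\<^sub>C y"
    and scaleC_add_left: "(a + b) *\<^sub>C x = a *\<^sub>C x + b *\<^sub>C x"
    and scaleC_scaleC: "a *\<^sub>C (b *\<^sub>C x) = (a * b) *\<^sub>C x"
    and scaleC_one: "1 *\<^sub>C x = x"

interpretation complex_vector: vector_space scaleC
  by unfold_locales (simp_all add: scaleC_add_right scaleC_add_left scaleC_scaleC scaleC_one)

abbreviation csubspace :: "'a::complex_vector set \<Rightarrow> bool"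
  where "csubspace \<equiv> module.subspace scaleC"

text \<open>
  The real structure (norm, metric, topology) comes from \<^class>\<open>real_inner\<close>, whose inner product is
  required to be the real part of the complex one; hence the norm of \<open>x\<close> is the square root of
  \<open>cinner x x\<close>. The complex inner product is linear in its first argument.
\<close>

class complex_inner = complex_vector + real_inner +
  fixes cinner :: "'a \<Rightarrow> 'a \<Rightarrow> complex"
  assumes scaleR_scaleC: "r *\<^sub>R x = complex_of_real r *\<^sub>C x"
    and cinner_commute: "cinner x y = cnj (cinner y x)"
    and cinner_add_left: "cinner (x + y) z = cinner x z + cinner y z"
    and cinner_scaleC_left: "cinner (c *\<^sub>C x) y = c * cinner x y"
    and inner_Re_cinner: "inner x y = Re (cinner x y)"

class chilbert_space = complex_inner + complete_space

instantiation complex :: chilbert_space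
begin
definition scaleC_complex :: "complex \<Rightarrow> complex \<Rightarrow> complex"
  where "scaleC_complex c x = c * x"
definition cinner_complex :: "complex \<Rightarrow> complex \<Rightarrow> complex"
  where "cinner_complex x y = x * cnj y"
instance
  by standard
    (simp_all add: scaleC_complex_def cinner_complex_def algebra_simps inner_complex_def scaleR_conv_of_real)
end

instantiation prod :: (complex_vector, complex_vector) complex_vector
begin
definition scaleC_prod :: "complex \<Rightarrow> 'a \<times> 'b \<Rightarrow> 'a \<times> 'b"
  where "scaleC_prod c p = (c *\<^sub>C fst p, c *\<^sub>C snd p)"
instance
  by standard
    (simp_all add: scaleC_prod_def scaleC_add_right scaleC_add_left scaleC_scaleC scaleC_one)
end

instantiation prod :: (complex_inner, complex_inner) complex_inner
begin
definition cinner_prod :: "'a \<times> 'b \<Rightarrow> 'a \<times> 'b \<Rightarrow> complex"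
  where "cinner_prod p q = cinner (fst p) (fst q) + cinner (snd p) (snd q)"
instance
proof
  fix x y z :: "'a \<times> 'b" and c :: complex and r :: real
  show "r *\<^sub>R x = complex_of_real r *\<^sub>C x"
    by (simp add: scaleC_prod_def scaleR_prod_def scaleR_scaleC)
  show "cinner x y = cnj (cinner y x)"
    by (metis cinner_prod_def cinner_commute complex_cnj_add)
  show "cinner (x + y) z = cinner x z + cinner y z"
    by (simp add: cinner_prod_def cinner_add_left)
  show "cinner (c *\<^sub>C x) y = c * cinner x y"
    by (simp add: cinner_prod_def scaleC_prod_def cinner_scaleC_left distrib_left)
  show "inner x y = Re (cinner x y)"
    by (simp add: cinner_prod_def inner_prod_def inner_Re_cinner)
qed
end

instance prod :: (chilbert_space, chilbert_space) chilbert_space ..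

section \<open>Hilbert spaces carried by a subspace\<close>

definition ip_norm :: "('k \<Rightarrow> 'k \<Rightarrow> complex) \<Rightarrow> 'k \<Rightarrow> real"
  where "ip_norm ip x = sqrt (Re (ip x x))"

text \<open>
  The set \<open>K\<close> with the linear structure of the surrounding type and the inner product \<open>ip\<close>, which is
  unrelated to any inner product the type itself may have, is a Hilbert space.
\<close>

locale hilbert_on =
  fixes K :: "'k::complex_vector set" and ip :: "'k \<Rightarrow> 'k \<Rightarrow> complex"
  assumes subspace_carrier: "csubspace K"
    and ip_commute: "\<lbrakk>x \<in> K; y \<in> K\<rbrakk> \<Longrightarrow> ip x y = cnj (ip y x)"
    and ip_add_left: "\<lbrakk>x \<in> K; y \<in> K; z \<in> K\<rbrakk> \<Longrightarrow> ip (x + y) z = ip x z + ip y z"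
    and ip_scaleC_left: "\<lbrakk>x \<in> K; y \<in> K\<rbrakk> \<Longrightarrow> ip (c *\<^sub>C x) y = c * ip x y"
    and ip_ge_zero: "x \<in> K \<Longrightarrow> 0 \<le> Re (ip x x)"
    and ip_eq_zero: "\<lbrakk>x \<in> K; ip x x = 0\<rbrakk> \<Longrightarrow> x = 0"
    and ip_complete: "\<lbrakk>\<And>n. X n \<in> K; \<And>e. e > 0 \<Longrightarrow> \<exists>N. \<forall>m\<ge>N. \<forall>n\<ge>N. ip_norm ip (X m - X n) < e\<rbrakk>
      \<Longrightarrow> \<exists>x\<in>K. (\<lambda>n. ip_norm ip (X n - x)) \<longlonglongrightarrow> 0"

definition bounded_clinear_on ::
    "'k::complex_vector set \<Rightarrow> ('k \<Rightarrow> 'k \<Rightarrow> complex) \<Rightarrow> ('k \<Rightarrow> 'v::complex_inner) \<Rightarrow> bool"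
  where "bounded_clinear_on K ip T \<longleftrightarrow>
    (\<forall>x\<in>K. \<forall>y\<in>K. T (x + y) = T x + T y) \<and>
    (\<forall>c. \<forall>x\<in>K. T (c *\<^sub>C x) = c *\<^sub>C T x) \<and>
    (\<exists>B. \<forall>x\<in>K. norm (T x) \<le> B * ip_norm ip x)"

section \<open>Semiclosed subspaces and linear relations\<close>

text \<open>
  \<open>S\<close> is the range of a bounded linear operator from some Hilbert space. HOL cannot quantify over
  the type of that Hilbert space inside a definition; here it lives on a subspace of the type of
  \<open>S\<close>. This is no restriction: \<open>semiclosed_range\<close> below admits operators from Hilbert spaces over
  arbitrary types.
\<close>

definition semiclosed :: "'v::chilbert_space set \<Rightarrow> bool"
  where "semiclosed S \<longleftrightarrow> csubspace S \<and>
    (\<exists>(K :: 'v set) ip T. hilbert_on K ip \<and> bounded_clinear_on K ip T \<and> T ` K = S)"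

abbreviation linear_relation :: "('h::complex_vector \<times> 'h) set \<Rightarrow> bool"
  where "linear_relation E \<equiv> csubspace E"

definition relation_ker :: "('h::complex_vector \<times> 'h) set \<Rightarrow> 'h set"
  where "relation_ker E = {x. (x, 0) \<in> E}"

text \<open>
  \<^const>\<open>relcomp\<close> composes from left to right: the product written \<open>RT\<close> for relations acting as
  operators is \<open>T O R\<close>.
\<close>

definition multivalued_projection :: "('h::complex_vector \<times> 'h) set \<Rightarrow> bool"
  where "multivalued_projection E \<longleftrightarrow> linear_relation E \<and> Range E \<subseteq> Domain E \<and> E O E = E"

definition operator_range_relation :: "('h::chilbert_space \<times> 'h) set \<Rightarrow> bool"
  where "operator_range_relation E \<longleftrightarrow> linear_relation E \<and> semiclosed E"

section \<open>Adequacy of the definition of semiclosed subspaces\<close>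

context hilbert_on
begin

lemma K_0: "0 \<in> K"
  and K_add: "x \<in> K \<Longrightarrow> y \<in> K \<Longrightarrow> x + y \<in> K"
  and K_scaleC: "x \<in> K \<Longrightarrow> c *\<^sub>C x \<in> K"
  and K_diff: "x \<in> K \<Longrightarrow> y \<in> K \<Longrightarrow> x - y \<in> K"
  using subspace_carrier
  by (auto intro: complex_vector.subspace_0 complex_vector.subspace_add
      complex_vector.subspace_scale complex_vector.subspace_diff)

lemmas K_closed = K_0 K_add K_scaleC K_diff

definition rip :: "'k \<Rightarrow> 'k \<Rightarrow> real"
  where "rip x y = Re (ip x y)"

lemma rip_commute: "x \<in> K \<Longrightarrow> y \<in> K \<Longrightarrow> rip x y = rip y x"
  unfolding rip_def by (subst ip_commute) simp_all

lemma rip_add_left: "x \<in> K \<Longrightarrow> y \<in> K \<Longrightarrow> z \<in> K \<Longrightarrow> rip (x + y) z = rip x z + rip y z"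
  unfolding rip_def by (simp add: ip_add_left)

lemma rip_scale_left: "x \<in> K \<Longrightarrow> y \<in> K \<Longrightarrow> rip (complex_of_real t *\<^sub>C x) y = t * rip x y"
  unfolding rip_def by (simp add: ip_scaleC_left)

lemma rip_diff_left: "x \<in> K \<Longrightarrow> y \<in> K \<Longrightarrow> z \<in> K \<Longrightarrow> rip (x - y) z = rip x z - rip y z"
  using rip_add_left[of "x - y" y z] by (simp add: K_closed)

lemma rip_add_right: "x \<in> K \<Longrightarrow> y \<in> K \<Longrightarrow> z \<in> K \<Longrightarrow> rip z (x + y) = rip z x + rip z y"
  by (metis rip_commute rip_add_left K_add)

lemma rip_diff_right: "x \<in> K \<Longrightarrow> y \<in> K \<Longrightarrow> z \<in> K \<Longrightarrow> rip z (x - y) = rip z x - rip z y"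
  by (metis rip_commute rip_diff_left K_diff)

lemma rip_scale_right: "x \<in> K \<Longrightarrow> y \<in> K \<Longrightarrow> rip y (complex_of_real t *\<^sub>C x) = t * rip y x"
  by (metis rip_commute rip_scale_left K_scaleC)

lemma rip_ge_0: "x \<in> K \<Longrightarrow> 0 \<le> rip x x"
  unfolding rip_def by (rule ip_ge_zero)

lemma rip_eq_0: "x \<in> K \<Longrightarrow> rip x x = 0 \<Longrightarrow> x = 0"
proof -
  assume x: "x \<in> K" and "rip x x = 0"
  moreover have "Im (ip x x) = 0"
    using arg_cong[OF ip_commute[OF x x], of Im] by simp
  ultimately show "x = 0"
    by (intro ip_eq_zero) (auto simp: rip_def complex_eq_iff)
qed

lemmas rip_simps = rip_add_left rip_add_right rip_diff_left rip_diff_right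
  rip_scale_left rip_scale_right

lemma rip_0_left: "x \<in> K \<Longrightarrow> rip 0 x = 0"
  using rip_add_left[of 0 0 x] by (simp add: K_0)

lemma norm_ip_eq: "ip_norm ip x = sqrt (rip x x)"
  by (simp add: ip_norm_def rip_def)

lemma norm_ip_ge_0: "x \<in> K \<Longrightarrow> 0 \<le> ip_norm ip x"
  by (simp add: norm_ip_eq rip_ge_0)

lemma rip_expand:
  assumes "x \<in> K" "y \<in> K"
  shows "rip (x + complex_of_real t *\<^sub>C y) (x + complex_of_real t *\<^sub>C y)
    = rip x x + 2 * t * rip x y + t\<^sup>2 * rip y y"
  using assms rip_commute[of x y]
  by (simp add: rip_simps K_closed power2_eq_square algebra_simps)

lemma rip_zero_of_min:
  assumes "x \<in> K" "y \<in> K" and *: "\<And>t. 0 \<le> a + 2 * t * rip x y + t\<^sup>2 * rip y y"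
  shows "(rip x y)\<^sup>2 \<le> a * rip y y"
proof (cases "rip y y = 0")
  case True
  then have "y = 0" using assms rip_eq_0 by blast
  then have "rip x y = 0" using assms rip_commute rip_0_left by metis
  then show ?thesis using True by simp
next
  case False
  then have pos: "rip y y > 0" using rip_ge_0[OF assms(2)] by simp
  have "0 \<le> (a + 2 * (- rip x y / rip y y) * rip x y + (- rip x y / rip y y)\<^sup>2 * rip y y) * rip y y"
    using *[of "- rip x y / rip y y"] pos by (intro mult_nonneg_nonneg) auto
  also have "\<dots> = a * rip y y - (rip x y)\<^sup>2"
    using pos by (simp add: field_simps power2_eq_square)
  finally show ?thesis by simp
qed

lemma rip_Cauchy_Schwarz:
  assumes "x \<in> K" "y \<in> K"
  shows "\<bar>rip x y\<bar> \<le> ip_norm ip x * ip_norm ip y"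
proof -
  have "(rip x y)\<^sup>2 \<le> rip x x * rip y y"
  proof (rule rip_zero_of_min[OF assms])
    fix t
    show "0 \<le> rip x x + 2 * t * rip x y + t\<^sup>2 * rip y y"
      unfolding rip_expand[OF assms, symmetric] by (intro rip_ge_0 K_closed assms)
  qed
  then have "sqrt ((rip x y)\<^sup>2) \<le> sqrt (rip x x * rip y y)"
    by (rule real_sqrt_le_mono)
  then show ?thesis by (simp add: norm_ip_eq real_sqrt_mult)
qed

lemma norm_ip_triangle:
  assumes "x \<in> K" "y \<in> K"
  shows "ip_norm ip (x + y) \<le> ip_norm ip x + ip_norm ip y"
proof -
  have "rip (x + y) (x + y) = rip x x + 2 * rip x y + rip y y"
    using assms rip_commute[of x y] by (simp add: rip_simps K_closed)
  also have "\<dots> \<le> (ip_norm ip x + ip_norm ip y)\<^sup>2"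
    using rip_Cauchy_Schwarz[OF assms] assms
    by (simp add: power2_sum norm_ip_eq rip_ge_0)
  finally show ?thesis
    using assms by (subst norm_ip_eq) (intro real_le_lsqrt add_nonneg_nonneg norm_ip_ge_0)
qed

lemma norm_ip_minus_commute: "x \<in> K \<Longrightarrow> y \<in> K \<Longrightarrow> ip_norm ip (x - y) = ip_norm ip (y - x)"
  by (simp add: norm_ip_eq rip_simps K_closed)

text \<open>Every fibre of a bounded operator contains a vector orthogonal to the kernel.\<close>

lemma orthogonal_preimage:
  assumes T: "bounded_clinear_on K ip T" and x0: "x0 \<in> K"
  shows "\<exists>x\<in>K. T x = T x0 \<and> (\<forall>n\<in>K. T n = 0 \<longrightarrow> rip x n = 0)"
proof -
  from T obtain B where add: "\<And>x y. x \<in> K \<Longrightarrow> y \<in> K \<Longrightarrow> T (x + y) = T x + T y"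
    and scale: "\<And>c x. x \<in> K \<Longrightarrow> T (c *\<^sub>C x) = c *\<^sub>C T x"
    and B: "\<And>x. x \<in> K \<Longrightarrow> norm (T x) \<le> B * ip_norm ip x"
    unfolding bounded_clinear_on_def by blast
  have diff: "T (x - y) = T x - T y" if "x \<in> K" "y \<in> K" for x y
    using add[of "x - y" y] that by (simp add: K_closed)
  define C where "C = {x \<in> K. T x = T x0}"
  define d where "d = Inf ((\<lambda>x. rip x x) ` C)"
  have C_K: "x \<in> K" if "x \<in> C" for x using that by (simp add: C_def)
  have "bdd_below ((\<lambda>x. rip x x) ` C)"
    by (rule bdd_belowI2[of _ 0]) (simp add: C_K rip_ge_0)
  then have d_le: "d \<le> rip x x" if "x \<in> C" for x
    unfolding d_def using that by (intro cInf_lower) auto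
  have ne: "(\<lambda>x. rip x x) ` C \<noteq> {}" using x0 by (auto simp: C_def)
  have d_ge_0: "0 \<le> d"
    unfolding d_def using ne by (intro cInf_greatest) (auto simp: C_K rip_ge_0)
  have "\<exists>x\<in>C. rip x x < d + inverse (real (Suc n))" for n
  proof -
    have "d < d + inverse (real (Suc n))" by simp
    then show ?thesis unfolding d_def using cInf_lessD[OF ne] by fastforce
  qed
  then obtain X where XC: "\<And>n. X n \<in> C" and Xd: "\<And>n. rip (X n) (X n) < d + inverse (real (Suc n))"
    by metis
  have XK: "X n \<in> K" for n using XC C_K by blast
  have mid: "complex_of_real (1/2) *\<^sub>C (x + y) \<in> C" if "x \<in> C" "y \<in> C" for x y
  proof -
    have "T (complex_of_real (1/2) *\<^sub>C (x + y)) = complex_of_real (1/2) *\<^sub>C (T x0 + T x0)"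
      using that by (simp add: C_def scale add K_closed)
    also have "T x0 + T x0 = complex_of_real 2 *\<^sub>C T x0"
      using scaleC_add_left[of 1 1 "T x0"] by (simp add: scaleC_one)
    finally show ?thesis
      using that by (simp add: C_def K_closed)
  qed
  have gap: "rip (x - y) (x - y) \<le> 2 * (rip x x - d) + 2 * (rip y y - d)"
    if "x \<in> C" "y \<in> C" for x y
  proof -
    have K: "x \<in> K" "y \<in> K" using that C_K by auto
    have m: "rip (complex_of_real (1/2) *\<^sub>C (x + y)) (complex_of_real (1/2) *\<^sub>C (x + y))
        = (rip x x + 2 * rip x y + rip y y) / 4"
      using K rip_commute[of x y]
      by (simp only: rip_simps K_closed) (simp add: field_simps)
    have "rip (x - y) (x - y) = rip x x - 2 * rip x y + rip y y"
      using K rip_commute[of x y] by (simp add: rip_simps K_closed)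
    then show ?thesis using d_le[OF mid[OF that]] m by simp
  qed
  have "\<exists>N. \<forall>m\<ge>N. \<forall>n\<ge>N. ip_norm ip (X m - X n) < e" if "e > 0" for e
  proof -
    from that have "e\<^sup>2 / 4 > 0" by simp
    then obtain N where N: "inverse (real (Suc N)) < e\<^sup>2 / 4"
      using reals_Archimedean by blast
    have "ip_norm ip (X m - X n) < e" if "m \<ge> N" "n \<ge> N" for m n
    proof -
      have "inverse (real (Suc m)) \<le> inverse (real (Suc N))" "inverse (real (Suc n)) \<le> inverse (real (Suc N))"
        using that by (auto intro!: le_imp_inverse_le)
      moreover
      have "rip (X m - X n) (X m - X n)
          < 2 * inverse (real (Suc m)) + 2 * inverse (real (Suc n))"
        using gap[OF XC XC, of m n] Xd[of m] Xd[of n] by (simp del: of_nat_Suc)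
      moreover have "4 * inverse (real (Suc N)) < e\<^sup>2"
        using N by (simp del: of_nat_Suc)
      ultimately have "rip (X m - X n) (X m - X n) < e\<^sup>2"
        by argo
      then have "sqrt (rip (X m - X n) (X m - X n)) < sqrt (e\<^sup>2)"
        by (rule real_sqrt_less_mono)
      then show ?thesis using \<open>e > 0\<close> by (simp add: norm_ip_eq)
    qed
    then show ?thesis by blast
  qed
  then obtain x where x: "x \<in> K" and lim: "(\<lambda>n. ip_norm ip (X n - x)) \<longlonglongrightarrow> 0"
    using ip_complete[of X] XK by blast
  have "norm (T x0 - T x) \<le> B * ip_norm ip (X n - x)" for n
    using B[of "X n - x"] diff[of "X n" x] XC[of n] x by (simp add: C_def K_closed)
  moreover have "(\<lambda>n. B * ip_norm ip (X n - x)) \<longlonglongrightarrow> 0"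
    using tendsto_mult_left[OF lim, of B] by simp
  ultimately have "norm (T x0 - T x) \<le> 0"
    by (intro LIMSEQ_le_const) auto
  then have Tx: "T x = T x0" by simp
  have "ip_norm ip x \<le> ip_norm ip (X n - x) + sqrt (d + inverse (real (Suc n)))" for n
  proof -
    have "ip_norm ip x = ip_norm ip ((x - X n) + X n)" by simp
    also have "\<dots> \<le> ip_norm ip (x - X n) + ip_norm ip (X n)"
      by (intro norm_ip_triangle K_closed x XK)
    also have "ip_norm ip (x - X n) = ip_norm ip (X n - x)"
      by (intro norm_ip_minus_commute x XK)
    also have "ip_norm ip (X n) \<le> sqrt (d + inverse (real (Suc n)))"
      using Xd[of n] by (simp add: norm_ip_eq)
    finally show ?thesis by simp
  qed
  moreover have "(\<lambda>n. ip_norm ip (X n - x) + sqrt (d + inverse (real (Suc n)))) \<longlonglongrightarrow> 0 + sqrt (d + 0)"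
    by (intro tendsto_intros lim LIMSEQ_inverse_real_of_nat)
  ultimately have "ip_norm ip x \<le> 0 + sqrt (d + 0)"
    by (intro LIMSEQ_le_const) auto
  then have xd: "rip x x \<le> d" by (simp add: norm_ip_eq)
  have "rip x n = 0" if n: "n \<in> K" "T n = 0" for n
  proof -
    have "0 \<le> 0 + 2 * t * rip x n + t\<^sup>2 * rip n n" for t
    proof -
      have "T (x + complex_of_real t *\<^sub>C n) = T x0"
        using n x Tx by (simp add: add scale K_closed)
      then have "d \<le> rip (x + complex_of_real t *\<^sub>C n) (x + complex_of_real t *\<^sub>C n)"
        using n x by (intro d_le) (simp add: C_def K_closed)
      then show ?thesis using xd rip_expand[OF x n(1), of t] by simp
    qed
    then have "(rip x n)\<^sup>2 \<le> 0 * rip n n"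
      using x n by (intro rip_zero_of_min) auto
    then show ?thesis by simp
  qed
  with x Tx show ?thesis by blast
qed

text \<open>The range of a bounded operator is a Hilbert space continuously embedded in the target.\<close>

lemma range_continuously_embedded:
  fixes T :: "'k \<Rightarrow> 'v::complex_inner"
  assumes T: "bounded_clinear_on K ip T"
  shows "\<exists>ip'. hilbert_on (T ` K) ip' \<and> bounded_clinear_on (T ` K) ip' (\<lambda>y. y)"
proof -
  from T obtain B where add: "\<And>x y. x \<in> K \<Longrightarrow> y \<in> K \<Longrightarrow> T (x + y) = T x + T y"
    and scale: "\<And>c x. x \<in> K \<Longrightarrow> T (c *\<^sub>C x) = c *\<^sub>C T x"
    and B: "\<And>x. x \<in> K \<Longrightarrow> norm (T x) \<le> B * ip_norm ip x"
    unfolding bounded_clinear_on_def by blast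
  have diff: "T (x - y) = T x - T y" if "x \<in> K" "y \<in> K" for x y
    using add[of "x - y" y] that by (simp add: K_closed)
  define P where "P = {x \<in> K. \<forall>n\<in>K. T n = 0 \<longrightarrow> rip x n = 0}"
  have P_K: "x \<in> K" if "x \<in> P" for x using that by (simp add: P_def)
  have P_add: "x + y \<in> P" if "x \<in> P" "y \<in> P" for x y
    using that by (simp add: P_def rip_simps K_closed)
  have P_diff: "x - y \<in> P" if "x \<in> P" "y \<in> P" for x y
    using that by (simp add: P_def rip_simps K_closed)
  have P_scale: "c *\<^sub>C x \<in> P" if "x \<in> P" for c x
  proof -
    have "rip (c *\<^sub>C x) n = 0" if n: "n \<in> K" "T n = 0" for n
    proof -
      have x: "x \<in> K" using \<open>x \<in> P\<close> by (rule P_K)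
      have "ip (c *\<^sub>C x) n = c * cnj (ip n x)"
        using x n ip_commute[of x n] by (simp add: ip_scaleC_left)
      also have "\<dots> = cnj (ip (cnj c *\<^sub>C n) x)"
        using x n by (simp add: ip_scaleC_left)
      also have "\<dots> = ip x (cnj c *\<^sub>C n)"
        by (rule ip_commute[symmetric]) (simp_all add: x n K_closed)
      finally have "rip (c *\<^sub>C x) n = rip x (cnj c *\<^sub>C n)" by (simp add: rip_def)
      moreover have "T (cnj c *\<^sub>C n) = 0" using n by (simp add: scale)
      ultimately show ?thesis
        using \<open>x \<in> P\<close> K_scaleC[OF n(1)] by (simp add: P_def)
    qed
    then show ?thesis using that by (simp add: P_def K_closed)
  qed
  have T_inj: "x = y" if "x \<in> P" "y \<in> P" "T x = T y" for x y
  proof -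
    have "T (x - y) = 0" using that by (simp add: diff P_K)
    moreover have "x - y \<in> P" by (rule P_diff[OF that(1,2)])
    ultimately have "x - y \<in> K" "rip (x - y) (x - y) = 0"
      unfolding P_def by blast+
    then have "x - y = 0" by (rule rip_eq_0)
    then show ?thesis by simp
  qed
  have "\<exists>x\<in>P. T x = y" if "y \<in> T ` K" for y
    using that orthogonal_preimage[OF T] by (fastforce simp: P_def)
  then obtain g where gP: "\<And>y. y \<in> T ` K \<Longrightarrow> g y \<in> P" and Tg: "\<And>y. y \<in> T ` K \<Longrightarrow> T (g y) = y"
    by metis
  have gK: "g y \<in> K" if "y \<in> T ` K" for y using gP[OF that] P_K by blast
  have gT: "g (T x) = x" if "x \<in> P" for x
    by (intro T_inj gP Tg imageI that P_K)
  have g_add: "g (y + z) = g y + g z" if "y \<in> T ` K" "z \<in> T ` K" for y z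
  proof -
    have "y + z = T (g y + g z)" using that by (simp add: add gK Tg)
    then show ?thesis using gT P_add gP that by metis
  qed
  have g_diff: "g (y - z) = g y - g z" if "y \<in> T ` K" "z \<in> T ` K" for y z
  proof -
    have "y - z = T (g y - g z)" using that by (simp add: diff gK Tg)
    then show ?thesis using gT P_diff gP that by metis
  qed
  have g_scale: "g (c *\<^sub>C y) = c *\<^sub>C g y" if "y \<in> T ` K" for c y
  proof -
    have "c *\<^sub>C y = T (c *\<^sub>C g y)" using that by (simp add: scale gK Tg)
    then show ?thesis using gT P_scale gP that by metis
  qed
  define ip' where "ip' y z = ip (g y) (g z)" for y z
  have norm': "ip_norm ip' y = ip_norm ip (g y)" for y by (simp add: ip_norm_def ip'_def)
  have sub: "csubspace (T ` K)"
  proof (rule complex_vector.subspaceI)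
    show "0 \<in> T ` K" using diff[OF K_0 K_0] K_0 by (metis diff_self imageI)
    show "x + y \<in> T ` K" if "x \<in> T ` K" "y \<in> T ` K" for x y
      using that by (metis add gK Tg K_add imageI)
    show "c *\<^sub>C x \<in> T ` K" if "x \<in> T ` K" for c x
      using that by (metis scale gK Tg K_scaleC imageI)
  qed
  have "hilbert_on (T ` K) ip'"
  proof
    show "csubspace (T ` K)" by (rule sub)
  next
    fix x y assume "x \<in> T ` K" "y \<in> T ` K"
    then show "ip' x y = cnj (ip' y x)" unfolding ip'_def using ip_commute gK by blast
  next
    fix x y z assume "x \<in> T ` K" "y \<in> T ` K" "z \<in> T ` K"
    then show "ip' (x + y) z = ip' x z + ip' y z"
      unfolding ip'_def using ip_add_left gK g_add by metis
  next
    fix x y c assume "x \<in> T ` K" "y \<in> T ` K"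
    then show "ip' (c *\<^sub>C x) y = c * ip' x y"
      unfolding ip'_def using ip_scaleC_left gK g_scale by metis
  next
    fix x assume "x \<in> T ` K"
    then show "0 \<le> Re (ip' x x)" unfolding ip'_def using ip_ge_zero gK by blast
  next
    fix x assume x: "x \<in> T ` K" "ip' x x = 0"
    then have "g x = 0" unfolding ip'_def using ip_eq_zero gK by blast
    then have "x = T 0" using Tg x by metis
    then show "x = 0" using diff[OF K_0 K_0] by simp
  next
    fix Y :: "nat \<Rightarrow> 'v"
    assume Y: "\<And>n. Y n \<in> T ` K"
      and Cauchy: "\<And>e. e > 0 \<Longrightarrow> \<exists>N. \<forall>m\<ge>N. \<forall>n\<ge>N. ip_norm ip' (Y m - Y n) < e"
    have "\<exists>x\<in>K. (\<lambda>n. ip_norm ip (g (Y n) - x)) \<longlonglongrightarrow> 0"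
      using Cauchy by (intro ip_complete) (simp_all add: gK Y norm' g_diff)
    then obtain x where x: "x \<in> K" and lim: "(\<lambda>n. ip_norm ip (g (Y n) - x)) \<longlonglongrightarrow> 0"
      by blast
    have "rip x k = 0" if k: "k \<in> K" "T k = 0" for k
    proof -
      have "\<bar>rip x k\<bar> \<le> ip_norm ip (g (Y n) - x) * ip_norm ip k" for n
      proof -
        have "rip (g (Y n)) k = 0" using gP[OF Y, of n] k by (simp add: P_def)
        then have "\<bar>rip x k\<bar> = \<bar>rip (g (Y n) - x) k\<bar>"
          using x k Y by (simp add: rip_simps gK)
        then show ?thesis
          using rip_Cauchy_Schwarz[of "g (Y n) - x" k] x k Y by (simp add: gK K_closed)
      qed
      moreover have "(\<lambda>n. ip_norm ip (g (Y n) - x) * ip_norm ip k) \<longlonglongrightarrow> 0"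
        using tendsto_mult_right[OF lim, of "ip_norm ip k"] by simp
      ultimately have "\<bar>rip x k\<bar> \<le> 0"
        by (intro LIMSEQ_le_const) auto
      then show ?thesis by simp
    qed
    then have "x \<in> P" using x by (simp add: P_def)
    then have "ip_norm ip' (Y n - T x) = ip_norm ip (g (Y n) - x)" for n
      using Y x by (simp add: norm' g_diff gT)
    then have "(\<lambda>n. ip_norm ip' (Y n - T x)) \<longlonglongrightarrow> 0"
      using lim by simp
    then show "\<exists>y\<in>T ` K. (\<lambda>n. ip_norm ip' (Y n - y)) \<longlonglongrightarrow> 0"
      using x by blast
  qed
  moreover have "norm y \<le> B * ip_norm ip' y" if "y \<in> T ` K" for y
    using B[OF gK[OF that]] Tg[OF that] by (simp add: norm')
  then have "bounded_clinear_on (T ` K) ip' (\<lambda>y. y)"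
    unfolding bounded_clinear_on_def by blast
  ultimately show ?thesis by blast
qed

end

theorem semiclosed_range:
  fixes K :: "'k::complex_vector set" and T :: "'k \<Rightarrow> 'v::chilbert_space"
  assumes "hilbert_on K ip" and "bounded_clinear_on K ip T"
  shows "semiclosed (T ` K)"
proof -
  from hilbert_on.range_continuously_embedded[OF assms]
  obtain ip' where ip': "hilbert_on (T ` K) ip'" "bounded_clinear_on (T ` K) ip' (\<lambda>y. y)"
    by blast
  moreover have "(\<lambda>y. y) ` T ` K = T ` K"
    by simp
  ultimately show ?thesis
    unfolding semiclosed_def using hilbert_on.subspace_carrier[OF ip'(1)] by blast
qed

theorem semiclosed_iff_continuously_embedded:
  fixes S :: "'v::chilbert_space set"
  shows "semiclosed S \<longleftrightarrow>
    (\<exists>ip. hilbert_on S ip \<and> (\<exists>B. \<forall>x\<in>S. norm x \<le> B * ip_norm ip x))"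
proof
  assume "semiclosed S"
  then obtain K :: "'v set" and ip T
    where "hilbert_on K ip" "bounded_clinear_on K ip T" and S: "T ` K = S"
    unfolding semiclosed_def by blast
  then obtain ip' where "hilbert_on S ip'" "bounded_clinear_on S ip' (\<lambda>y. y)"
    using hilbert_on.range_continuously_embedded by blast
  then show "\<exists>ip. hilbert_on S ip \<and> (\<exists>B. \<forall>x\<in>S. norm x \<le> B * ip_norm ip x)"
    unfolding bounded_clinear_on_def by blast
next
  assume "\<exists>ip. hilbert_on S ip \<and> (\<exists>B. \<forall>x\<in>S. norm x \<le> B * ip_norm ip x)"
  then obtain ip where "hilbert_on S ip" "bounded_clinear_on S ip (\<lambda>x. x)"
    unfolding bounded_clinear_on_def by blast
  then show "semiclosed S"
    using semiclosed_range[of S ip "\<lambda>x. x"] by simp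
qed

text \<open>A whole Hilbert space type is covered as the case \<open>K = UNIV\<close>, \<open>ip = cinner\<close>.\<close>

lemma hilbert_on_UNIV: "hilbert_on (UNIV :: 'v::chilbert_space set) cinner"
proof
  have n: "ip_norm cinner x = norm x" for x :: 'v
    by (simp add: ip_norm_def norm_eq_sqrt_inner inner_Re_cinner)
  fix x y z :: 'v and c :: complex
  show "csubspace (UNIV :: 'v set)" by simp
  show "cinner x y = cnj (cinner y x)" by (rule cinner_commute)
  show "cinner (x + y) z = cinner x z + cinner y z" by (rule cinner_add_left)
  show "cinner (c *\<^sub>C x) y = c * cinner x y" by (rule cinner_scaleC_left)
  show "0 \<le> Re (cinner x x)" by (metis inner_Re_cinner inner_ge_zero)
  show "x = 0" if "cinner x x = 0" using that inner_Re_cinner[of x x] by simp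
  show "\<exists>x\<in>UNIV. (\<lambda>n. ip_norm cinner (X n - x)) \<longlonglongrightarrow> 0"
    if "\<And>e. e > 0 \<Longrightarrow> \<exists>N. \<forall>m\<ge>N. \<forall>n\<ge>N. ip_norm cinner (X m - X n) < e" for X :: "nat \<Rightarrow> 'v"
  proof -
    have "Cauchy X" using that unfolding Cauchy_def n dist_norm by blast
    then obtain x where "X \<longlonglongrightarrow> x" using Cauchy_convergent convergent_def by blast
    then show ?thesis unfolding n by (intro bexI[of _ x] tendsto_norm_zero LIM_zero) auto
  qed
qed

end

(*
  A multivalued projection E is determined by M = ran E and N = ker E: it consists of the
  pairs (m + n, m) with m in M and n in N. So E is the image of the Hilbert space M x N under
  (m, n) |-> (m + n, m) when M and N are semiclosed. Conversely, ran E is the image of E under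
  the second projection, and ker E is the image, under the first projection, of the subspace of
  pairs in E with vanishing second component, which is closed for the Hilbert norm of E.
*)
theory Submission
  imports Defs
begin

lemma bounded_clinear_onI:
  assumes "\<And>x y. x \<in> K \<Longrightarrow> y \<in> K \<Longrightarrow> T (x + y) = T x + T y"
    and "\<And>c x. x \<in> K \<Longrightarrow> T (c *\<^sub>C x) = c *\<^sub>C T x"
    and "\<And>x. x \<in> K \<Longrightarrow> norm (T x) \<le> B * ip_norm ip x"
  shows "bounded_clinear_on K ip T"
  using assms unfolding bounded_clinear_on_def by blast

text \<open>The norm of a pair is the Euclidean combination of the norms of its components, so it
  dominates both of them. Cauchy sequences therefore split into two componentwise Cauchy sequences,
  and the two limits recombine to a limit of pairs.\<close>

lemma hilbert_on_Times:
  assumes "hilbert_on K ip" and "hilbert_on L iq"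
  shows "hilbert_on (K \<times> L) (\<lambda>p q. ip (fst p) (fst q) + iq (snd p) (snd q))"
    (is "hilbert_on _ ?ip")
proof -
  interpret K: hilbert_on K ip by fact
  interpret L: hilbert_on L iq by fact
  have sq: "ip_norm ?ip p = sqrt ((ip_norm ip (fst p))\<^sup>2 + (ip_norm iq (snd p))\<^sup>2)"
    if "p \<in> K \<times> L" for p
    using that by (auto simp: ip_norm_def K.ip_ge_zero L.ip_ge_zero)
  have sub: "csubspace (K \<times> L)"
    by (rule complex_vector.subspaceI)
      (auto simp: K.K_closed L.K_closed zero_prod_def scaleC_prod_def)
  show ?thesis
  proof
    show "csubspace (K \<times> L)" by (rule sub)
  next
    fix x y assume "x \<in> K \<times> L" "y \<in> K \<times> L"
    then show "?ip x y = cnj (?ip y x)"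
      using K.ip_commute[of "fst x" "fst y"] L.ip_commute[of "snd x" "snd y"]
      by (simp add: mem_Times_iff)
  next
    fix x y z assume "x \<in> K \<times> L" "y \<in> K \<times> L" "z \<in> K \<times> L"
    then show "?ip (x + y) z = ?ip x z + ?ip y z"
      by (simp add: mem_Times_iff K.ip_add_left L.ip_add_left)
  next
    fix x y c assume "x \<in> K \<times> L" "y \<in> K \<times> L"
    then show "?ip (c *\<^sub>C x) y = c * ?ip x y"
      by (simp add: mem_Times_iff scaleC_prod_def K.ip_scaleC_left L.ip_scaleC_left distrib_left)
  next
    fix x assume "x \<in> K \<times> L"
    then show "0 \<le> Re (?ip x x)"
      by (simp add: mem_Times_iff K.ip_ge_zero L.ip_ge_zero)
  next
    fix x assume x: "x \<in> K \<times> L" "?ip x x = 0"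
    \<comment> \<open>Taking real parts turns the single complex equation into a vanishing sum of
      two nonnegative reals, so both summands vanish.\<close>
    then have "K.rip (fst x) (fst x) + L.rip (snd x) (snd x) = 0"
      unfolding K.rip_def L.rip_def by (metis plus_complex.sel(1) zero_complex.sel(1))
    moreover have "0 \<le> K.rip (fst x) (fst x)" "0 \<le> L.rip (snd x) (snd x)"
      using x by (auto intro: K.rip_ge_0 L.rip_ge_0)
    ultimately have "fst x = 0" "snd x = 0"
      using x by (auto intro!: K.rip_eq_0 L.rip_eq_0)
    then show "x = 0" by (simp add: prod_eq_iff)
  next
    fix X :: "nat \<Rightarrow> 'a \<times> 'b"
    assume X: "\<And>n. X n \<in> K \<times> L"
      and Cauchy: "\<And>e. e > 0 \<Longrightarrow> \<exists>N. \<forall>m\<ge>N. \<forall>n\<ge>N. ip_norm ?ip (X m - X n) < e"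
    have XK: "fst (X n) \<in> K" and XL: "snd (X n) \<in> L" for n
      using X[of n] by auto
    have D: "X m - X n \<in> K \<times> L" for m n
      by (intro complex_vector.subspace_diff sub X)
    have le: "ip_norm ip (fst (X m) - fst (X n)) \<le> ip_norm ?ip (X m - X n)"
      "ip_norm iq (snd (X m) - snd (X n)) \<le> ip_norm ?ip (X m - X n)" for m n
      unfolding sq[OF D] by (simp_all add: real_le_rsqrt)
    have "\<exists>N. \<forall>m\<ge>N. \<forall>n\<ge>N. ip_norm ip (fst (X m) - fst (X n)) < e" if "e > 0" for e
      using Cauchy[OF that] le_less_trans[OF le(1)] by fast
    from K.ip_complete[OF XK this]
    obtain x where x: "x \<in> K" "(\<lambda>n. ip_norm ip (fst (X n) - x)) \<longlonglongrightarrow> 0" by blast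
    have "\<exists>N. \<forall>m\<ge>N. \<forall>n\<ge>N. ip_norm iq (snd (X m) - snd (X n)) < e" if "e > 0" for e
      using Cauchy[OF that] le_less_trans[OF le(2)] by fast
    from L.ip_complete[OF XL this]
    obtain y where y: "y \<in> L" "(\<lambda>n. ip_norm iq (snd (X n) - y)) \<longlonglongrightarrow> 0" by blast
    have xy: "X n - (x, y) \<in> K \<times> L" for n
      using x y X by (intro complex_vector.subspace_diff sub) auto
    have "(\<lambda>n. sqrt ((ip_norm ip (fst (X n) - x))\<^sup>2 + (ip_norm iq (snd (X n) - y))\<^sup>2))
        \<longlonglongrightarrow> sqrt (0\<^sup>2 + 0\<^sup>2)"
      by (intro tendsto_intros x y)
    then have "(\<lambda>n. ip_norm ?ip (X n - (x, y))) \<longlonglongrightarrow> 0"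
      by (simp add: sq[OF xy])
    then show "\<exists>z\<in>K \<times> L. (\<lambda>n. ip_norm ?ip (X n - z)) \<longlonglongrightarrow> 0"
      using x y by blast
  qed
qed

text \<open>Only completeness needs an argument: boundedness makes the kernel of \<open>T\<close>
  closed for the norm of \<open>ip\<close>, so a limit found in \<open>K\<close> stays in the
  kernel.\<close>

lemma (in hilbert_on) hilbert_on_kernel:
  assumes T: "bounded_clinear_on K ip T"
  shows "hilbert_on {x \<in> K. T x = 0} ip"
proof -
  from T obtain B where add: "\<And>x y. x \<in> K \<Longrightarrow> y \<in> K \<Longrightarrow> T (x + y) = T x + T y"
    and scale: "\<And>c x. x \<in> K \<Longrightarrow> T (c *\<^sub>C x) = c *\<^sub>C T x"
    and B: "\<And>x. x \<in> K \<Longrightarrow> norm (T x) \<le> B * ip_norm ip x"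
    unfolding bounded_clinear_on_def by blast
  have diff: "T (x - y) = T x - T y" if "x \<in> K" "y \<in> K" for x y
    using add[of "x - y" y] that by (simp add: K_closed)
  show ?thesis
  proof
    show "csubspace {x \<in> K. T x = 0}"
      using diff[OF K_0 K_0] by (intro complex_vector.subspaceI) (auto simp: K_closed add scale)
  next
    fix X :: "nat \<Rightarrow> 'k"
    assume X: "\<And>n. X n \<in> {x \<in> K. T x = 0}"
      and Cauchy: "\<And>e. e > 0 \<Longrightarrow> \<exists>N. \<forall>m\<ge>N. \<forall>n\<ge>N. ip_norm ip (X m - X n) < e"
    obtain x where x: "x \<in> K" and lim: "(\<lambda>n. ip_norm ip (X n - x)) \<longlonglongrightarrow> 0"
      using ip_complete[of X] X Cauchy by blast
    \<comment> \<open>Since \<open>T (X n) = 0\<close>, the vector \<open>T (X n - x)\<close> is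
      \<open>- T x\<close>.\<close>
    have "norm (T x) \<le> B * ip_norm ip (X n - x)" for n
      using B[of "X n - x"] diff[of "X n" x] X[of n] x by (simp add: K_closed)
    moreover have "(\<lambda>n. B * ip_norm ip (X n - x)) \<longlonglongrightarrow> 0"
      using tendsto_mult_left[OF lim, of B] by simp
    ultimately have "norm (T x) \<le> 0"
      by (intro LIMSEQ_le_const) auto
    with x lim show "\<exists>x\<in>{x \<in> K. T x = 0}. (\<lambda>n. ip_norm ip (X n - x)) \<longlonglongrightarrow> 0" by auto
  qed (auto intro: ip_commute ip_add_left ip_scaleC_left ip_ge_zero ip_eq_zero)
qed

text \<open>On the zero subspace the embedding constant may be negative. Replacing it by
  \<open>max B 0\<close> allows it to be used as a monotone factor in later estimates.\<close>

lemma semiclosed_embeddingE: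
  assumes "semiclosed S"
  obtains ip B where "hilbert_on S ip" "B \<ge> 0" "\<And>x. x \<in> S \<Longrightarrow> norm x \<le> B * ip_norm ip x"
proof -
  obtain ip B where ip: "hilbert_on S ip" and B: "\<forall>x\<in>S. norm x \<le> B * ip_norm ip x"
    using assms unfolding semiclosed_iff_continuously_embedded by blast
  have "norm x \<le> max B 0 * ip_norm ip x" if "x \<in> S" for x
    using B that mult_right_mono[of B "max B 0" "ip_norm ip x"] hilbert_on.norm_ip_ge_0[OF ip that]
    by fastforce
  with ip show ?thesis by (intro that[of ip "max B 0"]) auto
qed

text \<open>The pairs \<open>(x, y)\<close> and \<open>(y, y)\<close> differ by
  \<open>(x - y, 0)\<close>. By linearity everything reduces to \<open>diag\<close>: the relation
  contains the diagonal over its range.\<close>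

lemma multivalued_projection_mem_iff:
  assumes "multivalued_projection E"
  shows "(x, y) \<in> E \<longleftrightarrow> y \<in> Range E \<and> x - y \<in> relation_ker E"
proof -
  have lin: "csubspace E" and dom: "Range E \<subseteq> Domain E" and idem: "E O E = E"
    using assms by (auto simp: multivalued_projection_def)
  have add: "(a + c, b + d) \<in> E" if "(a, b) \<in> E" "(c, d) \<in> E" for a b c d
    using complex_vector.subspace_add[OF lin that] by simp
  have diff: "(a - c, b - d) \<in> E" if "(a, b) \<in> E" "(c, d) \<in> E" for a b c d
    using complex_vector.subspace_diff[OF lin that] by simp
  \<comment> \<open>The multivalued part lies in the kernel. As \<open>w\<close> is in the range, it
    is in the domain, with some image \<open>v\<close>. Composition gives \<open>(0, v)\<close>, and
    subtracting it from \<open>(w, v)\<close> leaves \<open>(w, 0)\<close>.\<close>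
  have mul: "(w, 0) \<in> E" if w: "(0, w) \<in> E" for w
  proof -
    obtain v where v: "(w, v) \<in> E" using w dom by blast
    then have "(0, v) \<in> E" using w idem by blast
    from diff[OF v this] show ?thesis by simp
  qed
  have diag: "(y, y) \<in> E" if y: "y \<in> Range E" for y
  proof -
    \<comment> \<open>Idempotence factors \<open>(x, y)\<close> through some \<open>z\<close>. Both
      \<open>z\<close> and \<open>y\<close> are images of \<open>x\<close>, so \<open>z - y\<close>
      lies in the multivalued part and \<open>mul\<close> puts \<open>(z - y, 0)\<close> into
      \<open>E\<close>. Subtracting this from \<open>(z, y)\<close> yields
      \<open>(y, y)\<close>.\<close>
    obtain x z where xz: "(x, z) \<in> E" and zy: "(z, y) \<in> E" and xy: "(x, y) \<in> E"
      using y idem by blast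
    have "(z - y, 0) \<in> E" using diff[OF xz xy] by (intro mul) simp
    from diff[OF zy this] show ?thesis by simp
  qed
  show ?thesis
  proof
    assume xy: "(x, y) \<in> E"
    then have y: "y \<in> Range E" by blast
    from diff[OF xy diag[OF y]] y show "y \<in> Range E \<and> x - y \<in> relation_ker E"
      by (simp add: relation_ker_def)
  next
    assume "y \<in> Range E \<and> x - y \<in> relation_ker E"
    then show "(x, y) \<in> E"
      using add[of y y "x - y" 0] diag[of y] by (simp add: relation_ker_def)
  qed
qed

lemma multivalued_projection_eq_image:
  assumes "multivalued_projection E"
  shows "E = (\<lambda>(m, n). (m + n, m)) ` (Range E \<times> relation_ker E)"
proof -
  have "(x, y) \<in> E \<longleftrightarrow> (x, y) \<in> (\<lambda>(m, n). (m + n, m)) ` (Range E \<times> relation_ker E)" for x y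
    unfolding multivalued_projection_mem_iff[OF assms] by (force simp: image_iff)
  then show ?thesis
    unfolding set_eq_iff split_paired_All by blast
qed

lemma semiclosed_Range:
  fixes E :: "('h::chilbert_space \<times> 'h) set"
  assumes "semiclosed E"
  shows "semiclosed (Range E)"
proof -
  obtain ip B where ip: "hilbert_on E ip" and B: "\<And>p. p \<in> E \<Longrightarrow> norm p \<le> B * ip_norm ip p"
    using semiclosed_embeddingE[OF assms] by metis
  \<comment> \<open>Boundedness refers to the Hilbert norm carried by \<open>E\<close>: it dominates
    the ambient norm of a pair, which in turn dominates the norm of each component.\<close>
  have "bounded_clinear_on E ip snd"
    by (rule bounded_clinear_onI[where B = B])
      (auto simp: scaleC_prod_def intro: order_trans[OF norm_snd_le B])
  then show ?thesis
    unfolding Range_snd by (rule semiclosed_range[OF ip])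
qed

lemma semiclosed_relation_ker:
  fixes E :: "('h::chilbert_space \<times> 'h) set"
  assumes "semiclosed E"
  shows "semiclosed (relation_ker E)"
proof -
  obtain ip B where ip: "hilbert_on E ip" and B: "\<And>p. p \<in> E \<Longrightarrow> norm p \<le> B * ip_norm ip p"
    using semiclosed_embeddingE[OF assms] by metis
  have "bounded_clinear_on E ip snd"
    by (rule bounded_clinear_onI[where B = B])
      (auto simp: scaleC_prod_def intro: order_trans[OF norm_snd_le B])
  \<comment> \<open>These pairs form the kernel of the bounded operator \<open>snd\<close> on
    \<open>E\<close>, so they inherit a complete norm from \<open>E\<close>; \<open>fst\<close> then
    maps them onto \<open>relation_ker E\<close>.\<close>
  then have "hilbert_on {p \<in> E. snd p = 0} ip"
    by (rule hilbert_on.hilbert_on_kernel[OF ip])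
  moreover have "bounded_clinear_on {p \<in> E. snd p = 0} ip fst"
    by (rule bounded_clinear_onI[where B = B])
      (auto simp: scaleC_prod_def intro: order_trans[OF norm_fst_le B])
  moreover have "relation_ker E = fst ` {p \<in> E. snd p = 0}"
    by (force simp: relation_ker_def)
  ultimately show ?thesis
    by (simp add: semiclosed_range)
qed

lemma semiclosed_sum_graph:
  fixes M N :: "'h::chilbert_space set"
  assumes "semiclosed M" and "semiclosed N"
  shows "semiclosed ((\<lambda>(m, n). (m + n, m)) ` (M \<times> N))"
proof -
  obtain ip B where ip: "hilbert_on M ip" and "B \<ge> 0"
    and B: "\<And>x. x \<in> M \<Longrightarrow> norm x \<le> B * ip_norm ip x"
    using semiclosed_embeddingE[OF assms(1)] by metis
  obtain iq C where iq: "hilbert_on N iq" and "C \<ge> 0"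
    and C: "\<And>x. x \<in> N \<Longrightarrow> norm x \<le> C * ip_norm iq x"
    using semiclosed_embeddingE[OF assms(2)] by metis
  interpret M: hilbert_on M ip by fact
  interpret N: hilbert_on N iq by fact
  let ?ip = "\<lambda>p q. ip (fst p) (fst q) + iq (snd p) (snd q)"
  have "bounded_clinear_on (M \<times> N) ?ip (\<lambda>(m, n). (m + n, m))"
  proof (rule bounded_clinear_onI)
    fix p assume "p \<in> M \<times> N"
    then obtain m n where p: "p = (m, n)" and mn: "m \<in> M" "n \<in> N" by blast
    have le: "ip_norm ip m \<le> ip_norm ?ip p" "ip_norm iq n \<le> ip_norm ?ip p"
      using mn by (simp_all add: p ip_norm_def M.ip_ge_zero N.ip_ge_zero)
    have "norm (m + n, m) \<le> norm (m + n) + norm m"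
      by (rule norm_Pair_le)
    \<comment> \<open>The vector \<open>m\<close> enters both components of
      \<open>(m + n, m)\<close>, which is the source of the factor 2 in the bound
      \<open>2 * B + C\<close>.\<close>
    also have "\<dots> \<le> 2 * norm m + norm n"
      using norm_triangle_ineq[of m n] by simp
    also have "\<dots> \<le> 2 * (B * ip_norm ip m) + C * ip_norm iq n"
      using B[OF mn(1)] C[OF mn(2)] by simp
    \<comment> \<open>Here the nonnegativity of \<open>B\<close> and \<open>C\<close> is essential:
      each component norm is replaced by the larger norm of the pair.\<close>
    also have "\<dots> \<le> 2 * (B * ip_norm ?ip p) + C * ip_norm ?ip p"
      using le \<open>B \<ge> 0\<close> \<open>C \<ge> 0\<close> by (intro add_mono mult_left_mono) auto
    also have "\<dots> = (2 * B + C) * ip_norm ?ip p"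
      by (simp add: algebra_simps)
    finally show "norm (case p of (m, n) \<Rightarrow> (m + n, m)) \<le> (2 * B + C) * ip_norm ?ip p"
      by (simp add: p)
  qed (auto simp: scaleC_prod_def scaleC_add_right)
  then show ?thesis
    by (rule semiclosed_range[OF hilbert_on_Times[OF ip iq]])
qed

theorem proposition5p2:
  fixes E :: "('h::chilbert_space \<times> 'h) set"
  assumes "separable_space (euclidean :: 'h topology)"
    and "multivalued_projection E"
  shows "operator_range_relation E \<longleftrightarrow> semiclosed (Range E) \<and> semiclosed (relation_ker E)"
proof
  assume "operator_range_relation E"
  then show "semiclosed (Range E) \<and> semiclosed (relation_ker E)"
    by (simp add: operator_range_relation_def semiclosed_Range semiclosed_relation_ker)
next
  assume "semiclosed (Range E) \<and> semiclosed (relation_ker E)"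
  then have "semiclosed E"
    by (subst multivalued_projection_eq_image[OF assms(2)]) (simp add: semiclosed_sum_graph)
  then show "operator_range_relation E"
    by (simp add: operator_range_relation_def semiclosed_def)
qed

end
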